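(* Let $C$ be a $d$-variate Archimedean copula with generator $\phi$ and let $(U_1,\ldots,U_d)$ have distribution function $C$. Suppose that $\phi(0)=\infty$, that $$\lim_{s\downarrow 0}\frac{s\,\phi'(s)}{\phi(s)}=0,$$ and that the function $\psi=-1/D(\log\phi^{\leftarrow})$ is regularly varying at infinity of finite index $\kappa$. Then $\kappa\leq 1$, and for every $\varnothing\neq I\subset\{1,\ldots,d\}$ and every $(x_i)_{i\in I}\in(0,\infty)^{|I|}$, $$\lim_{s\downarrow 0}\frac{1}{\phi^{\leftarrow}(|I|\phi(s))}\Pr[\forall i\in I: U_i\leq s x_i]=\prod_{i\in I}x_i^{|I|^{-\kappa}}.$$
   Context: Fix an integer $d\geq 2$. An Archimedean generator is a convex, decreasing function $\phi:[0,1]\to[0,\infty]$ with $\phi(1)=0$; its generalized inverse is $\phi^{\leftarrow}(y)=\inf\{t\in[0,1]:\phi(t)\leq y\}$ for $y\in[0,\infty]$. The Archimedean copula with generator $\phi$ is $C(u_1,\ldots,u_d)=\phi^{\leftarrow}(\phi(u_1)+\cdots+\phi(u_d))$ on $[0,1]^d$; it is assumed throughout that $C$ is indeed a copula, i.e. (the restriction to $[0,1]^d$ of) a distribution function with uniform$(0,1)$ margins (equivalently, $\phi^{\leftarrow}$ is $d$-monotone on $(0,\infty)$). $\phi'$ denotes a non-decreasing version of the Radon-Nikodym derivative of $\phi$. $D$ is the derivative operator; the derivative of $\phi^{\leftarrow}$ is taken consistently with $\phi'$, so that $\psi(t)=-\phi^{\leftarrow}(t)\,\phi'(\phi^{\leftarrow}(t))$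 and $\psi(\phi(s))=-s\phi'(s)$. A positive measurable function $f$ defined in a neighbourhood of infinity is regularly varying at infinity of finite index $\kappa\in\mathbb{R}$ if $f(tx)/f(t)\to x^{\kappa}$ as $t\to\infty$ for every $x>0$. *)

theory Defs
  imports "HOL-Probability.Probability"
begin

text \<open>
  Generators are functions on the reals with values in \<^typ>\<open>ennreal\<close>; only their restriction to the
  unit interval matters. In \<^typ>\<open>ennreal\<close> we have \<open>0 * \<infinity> = 0\<close>, so the convexity inequality is
  trivial for \<open>t = 0\<close> and \<open>t = 1\<close>. Monotonicity is not required to be strict.
\<close>

definition archimedean_generator :: "(real \<Rightarrow> ennreal) \<Rightarrow> bool" where
  "archimedean_generator \<phi> \<longleftrightarrow>
     (\<forall>x\<in>{0..1}. \<forall>y\<in>{0..1}. \<forall>t\<in>{0..1}.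
        \<phi> ((1 - t) * x + t * y) \<le> ennreal (1 - t) * \<phi> x + ennreal t * \<phi> y) \<and>
     antimono_on {0..1} \<phi> \<and> \<phi> 1 = 0"

definition gen_inverse :: "(real \<Rightarrow> ennreal) \<Rightarrow> ennreal \<Rightarrow> real" where
  "gen_inverse \<phi> y = Inf {t \<in> {0..1}. \<phi> t \<le> y}"

definition archimedean_copula :: "nat \<Rightarrow> (real \<Rightarrow> ennreal) \<Rightarrow> (nat \<Rightarrow> real) \<Rightarrow> real" where
  "archimedean_copula d \<phi> u = gen_inverse \<phi> (\<Sum>i\<in>{1..d}. \<phi> (u i))"

text \<open>
  The function \<open>C\<close> is only used on the unit cube. If \<open>C\<close> is a copula, this determines the joint
  distribution of \<open>U 1, \<dots>, U d\<close>, since then \<open>C\<close> equals 1 at \<open>(1, \<dots>, 1)\<close> and 0 whenever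
  a coordinate is 0.
\<close>

definition has_df_on_cube ::
    "nat \<Rightarrow> 'w measure \<Rightarrow> (nat \<Rightarrow> 'w \<Rightarrow> real) \<Rightarrow> ((nat \<Rightarrow> real) \<Rightarrow> real) \<Rightarrow> bool" where
  "has_df_on_cube d M U C \<longleftrightarrow>
     prob_space M \<and> (\<forall>i\<in>{1..d}. U i \<in> borel_measurable M) \<and>
     (\<forall>u. (\<forall>i\<in>{1..d}. u i \<in> {0..1}) \<longrightarrow>
        \<P>(\<omega> in M. \<forall>i\<in>{1..d}. U i \<omega> \<le> u i) = C u)"

definition is_copula :: "nat \<Rightarrow> ((nat \<Rightarrow> real) \<Rightarrow> real) \<Rightarrow> bool" where
  "is_copula d C \<longleftrightarrow>
     (\<exists>\<mu>. sets \<mu> = sets (Pi\<^sub>M {1..d} (\<lambda>_. borel :: real measure)) \<and>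
        has_df_on_cube d \<mu> (\<lambda>i x. x i) C \<and>
        (\<forall>i\<in>{1..d}. distr \<mu> borel (\<lambda>x. x i) = uniform_measure lborel {0<..<1}))"

text \<open>
  A non-decreasing version of the Radon-Nikodym derivative of a generator. Only the values on the
  open unit interval are constrained; \<open>\<phi>\<close> is finite on \<open>(0, 1]\<close> whenever the Archimedean
  function it generates is a copula.
\<close>

definition monotone_RN_derivative :: "(real \<Rightarrow> ennreal) \<Rightarrow> (real \<Rightarrow> real) \<Rightarrow> bool" where
  "monotone_RN_derivative \<phi> \<phi>' \<longleftrightarrow>
     mono_on {0<..<1} \<phi>' \<and>
     (\<forall>s t. 0 < s \<and> s \<le> t \<and> t \<le> 1 \<longrightarrow>
        set_integrable lborel {s..t} \<phi>' \<and>
        enn2real (\<phi> t) - enn2real (\<phi> s) = (LBINT u:{s..t}. \<phi>' u))"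

text \<open>
  The inverse of \<open>\<phi>\<close> need not be differentiable everywhere (for \<open>d = 2\<close> it is merely convex), so
  its derivative is the version obtained from \<open>\<phi>'\<close> by the inverse function rule, and the derivative
  of its logarithm follows by the chain rule.
\<close>

definition D_gen_inverse :: "(real \<Rightarrow> ennreal) \<Rightarrow> (real \<Rightarrow> real) \<Rightarrow> real \<Rightarrow> real" where
  "D_gen_inverse \<phi> \<phi>' t = 1 / \<phi>' (gen_inverse \<phi> (ennreal t))"

definition D_log_gen_inverse :: "(real \<Rightarrow> ennreal) \<Rightarrow> (real \<Rightarrow> real) \<Rightarrow> real \<Rightarrow> real" where
  "D_log_gen_inverse \<phi> \<phi>' t = D_gen_inverse \<phi> \<phi>' t / gen_inverse \<phi> (ennreal t)"

definition psi :: "(real \<Rightarrow> ennreal) \<Rightarrow> (real \<Rightarrow> real) \<Rightarrow> real \<Rightarrow> real" where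
  "psi \<phi> \<phi>' t = - 1 / D_log_gen_inverse \<phi> \<phi>' t"

lemma psi_eq:
  "psi \<phi> \<phi>' t = - gen_inverse \<phi> (ennreal t) * \<phi>' (gen_inverse \<phi> (ennreal t))"
  by (simp add: psi_def D_log_gen_inverse_def D_gen_inverse_def)

definition regularly_varying_at_top :: "(real \<Rightarrow> real) \<Rightarrow> real \<Rightarrow> bool" where
  "regularly_varying_at_top f \<kappa> \<longleftrightarrow>
     (\<exists>a. f \<in> borel_measurable (restrict_space borel {a..}) \<and> (\<forall>t\<ge>a. f t > 0)) \<and>
     (\<forall>x>0. ((\<lambda>t. f (t * x) / f t) \<longlongrightarrow> x powr \<kappa>) at_top)"

end

theory Submission
  imports Defs
begin

text \<open>
  Put \<open>F = \<phi>\<close> and \<open>G = \<phi>\<^sup>\<leftarrow>\<close>. The density of \<open>- F\<close> at \<open>u\<close> is \<open>\<psi> (F u) / u\<close>.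
  The limit assumption makes \<open>F\<close> slowly varying at 0, so by the uniform convergence theorem
  for regularly varying functions \<open>\<psi> (F u)\<close> is asymptotically constant over \<open>u \<in> {s..s * x}\<close>,
  whence \<open>F (s * x) = F s - \<psi> (F s) * (ln x + o(1))\<close>. Therefore
  \<open>(\<Sum>i\<in>I. F (s * x i)) = T - \<psi> T * (\<bar>I\<bar> powr - \<kappa> * (\<Sum>i\<in>I. ln (x i)) + o(1))\<close> with
  \<open>T = \<bar>I\<bar> * F s\<close>, and inverting the same expansion at \<open>G T\<close> gives the limit. The bound
  \<open>\<kappa> \<le> 1\<close> holds because \<open>\<psi> t / t\<close> tends to 0.
\<close>

section \<open>Uniform convergence for regularly varying functions\<close>

text \<open>The uniform convergence theorem in additive form. The shift is restricted to at most 1/2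
  so that the unit intervals starting at \<open>x\<close> and at \<open>y\<close> overlap in a set
  of fixed positive length.\<close>

lemma regularly_varying_log_uniform:
  assumes rv: "regularly_varying_at_top f \<kappa>" and "e > 0"
  shows "\<exists>X. \<forall>x\<ge>X. \<forall>y\<in>{x..x + 1/2}. \<bar>ln (f (exp y)) - ln (f (exp x)) - \<kappa> * (y - x)\<bar> < e"
proof -
  obtain a where meas: "f \<in> borel_measurable (restrict_space borel {a..})"
    and pos: "\<And>t. t \<ge> a \<Longrightarrow> f t > 0"
    and lim: "\<And>x. x > 0 \<Longrightarrow> ((\<lambda>t. f (t * x) / f t) \<longlongrightarrow> x powr \<kappa>) at_top"
    using rv unfolding regularly_varying_at_top_def by blast
  define b where "b = ln (max a 1)"
  have b: "exp x \<ge> a" if "x \<ge> b" for x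
    using that unfolding b_def
    by (metis exp_ln_iff exp_le_cancel_iff less_max_iff_disj max.boundedE zero_less_one)
  \<comment> \<open>\<open>f\<close> is measurable only on \<open>{a..}\<close>; the value 0 chosen
    for the logarithm below \<open>a\<close> makes \<open>k\<close> measurable on the whole
    line.\<close>
  define k where "k x = (if exp x \<ge> a then ln (f (exp x)) else 0) - \<kappa> * x" for x
  have k_eq: "k x = ln (f (exp x)) - \<kappa> * x" if "x \<ge> b" for x
    using b[OF that] by (simp add: k_def)
  have "(\<lambda>t. if a \<le> t then f t else 0) \<in> borel_measurable borel"
  proof -
    have "(\<lambda>t. indicator {a..} t *\<^sub>R f t) \<in> borel_measurable borel"
      using meas by (subst (asm) borel_measurable_restrict_space_iff) (auto simp: mult.commute)
    also have "(\<lambda>t. indicator {a..} t *\<^sub>R f t) = (\<lambda>t. if a \<le> t then f t else 0)"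
      by auto
    finally show ?thesis .
  qed
  hence meas_k [measurable]: "k \<in> borel_measurable borel"
  proof -
    assume [measurable]: "(\<lambda>t. if a \<le> t then f t else 0) \<in> borel_measurable borel"
    have "k = (\<lambda>x. (if exp x \<ge> a then ln ((\<lambda>t. if a \<le> t then f t else 0) (exp x)) else 0) - \<kappa> * x)"
      by (auto simp: k_def)
    also have "\<dots> \<in> borel_measurable borel" by measurable
    finally show ?thesis .
  qed
  have k_lim: "((\<lambda>x. k (x + u) - k x) \<longlongrightarrow> 0) at_top" if "u \<ge> 0" for u
  proof -
    have "((\<lambda>x. f (exp x * exp u) / f (exp x)) \<longlongrightarrow> exp u powr \<kappa>) at_top"
      by (rule filterlim_compose[OF lim exp_at_top]) simp
    hence "((\<lambda>x. ln (f (exp x * exp u) / f (exp x)) - \<kappa> * u) \<longlongrightarrow> ln (exp u powr \<kappa>) - \<kappa> * u) at_top"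
      by (intro tendsto_intros) auto
    moreover have "\<forall>\<^sub>F x in at_top. ln (f (exp x * exp u) / f (exp x)) - \<kappa> * u = k (x + u) - k x"
      using eventually_ge_at_top[of b]
    proof eventually_elim
      case (elim x)
      hence "f (exp x) > 0" "f (exp (x + u)) > 0"
        using that by (auto intro!: pos b)
      thus ?case using elim that
        by (simp add: k_eq ln_div exp_add algebra_simps)
    qed
    ultimately show ?thesis
      by (simp add: ln_powr tendsto_cong mult.commute)
  qed
  \<comment> \<open>\<open>J\<close> tends to 0 by dominated convergence. If \<open>y \<in> {x..x + 1/2}\<close>, then \<open>{x + 1/2..x + 1}\<close> lies in
    both \<open>{x..x + 1}\<close> and \<open>{y..y + 1}\<close>, and averaging the triangle inequality through \<open>k z\<close> over \<open>z\<close>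
    in that interval bounds \<open>k y - k x\<close> by \<open>J x + J y\<close>, uniformly in \<open>y\<close>.\<close>
  define J where "J x = (LBINT u:{0..1}. min 1 \<bar>k (x + u) - k x\<bar>)" for x
  have J_lim: "(J \<longlongrightarrow> 0) at_top"
  proof -
    have "(J \<longlongrightarrow> (LINT u|(lborel :: real measure). 0)) at_top"
      unfolding J_def set_lebesgue_integral_def
    proof (rule integral_dominated_convergence_at_top[where w = "indicator {0..1}" and f = "\<lambda>_. 0"
          and s = "\<lambda>x u. indicator {0..1} u *\<^sub>R min 1 \<bar>k (x + u) - k x\<bar>"])
      show "AE u in lborel. ((\<lambda>x. indicator {0..1} u *\<^sub>R min 1 \<bar>k (x + u) - k x\<bar>) \<longlongrightarrow> 0) at_top"
      proof (intro AE_I2)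
        fix u :: real
        show "((\<lambda>x. indicator {0..1} u *\<^sub>R min 1 \<bar>k (x + u) - k x\<bar>) \<longlongrightarrow> 0) at_top"
        proof (cases "u \<in> {0..1}")
          case True
          hence "((\<lambda>x. min 1 \<bar>k (x + u) - k x\<bar>) \<longlongrightarrow> min 1 \<bar>0\<bar>) at_top"
            by (intro tendsto_intros k_lim) auto
          thus ?thesis using True by simp
        qed simp
      qed
      show "\<forall>\<^sub>F x in at_top. AE u in lborel. norm (indicator {0..1} u *\<^sub>R min 1 \<bar>k (x + u) - k x\<bar>) \<le> indicator {0..1} u"
        by (intro always_eventually allI AE_I2) (auto simp: indicator_def)
    qed auto
    thus ?thesis by simp
  qed
  have int: "set_integrable lborel {l..u} (\<lambda>z. min 1 \<bar>k (z + c) - k x\<bar>)" for l u c x :: real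
    unfolding set_integrable_def
    by (rule Bochner_Integration.integrable_bound[where f = "indicator {l..u} :: real \<Rightarrow> real"])
       (auto simp: indicator_def integrable_indicator_iff emeasure_lborel_Icc_eq)
  have J_ge: "(LBINT z:{x+1/2..x+1}. min 1 \<bar>k z - k y\<bar>) \<le> J y" if y: "y \<in> {x..x+1/2}" for x y
  proof -
    have "(LBINT z:{x+1/2..x+1}. min 1 \<bar>k z - k y\<bar>)
        = (LINT u|lborel. indicator {x+1/2..x+1} (y + u) *\<^sub>R min 1 \<bar>k (y + u) - k y\<bar>)"
      unfolding set_lebesgue_integral_def
      by (subst lborel_integral_real_affine[where c = 1 and t = y]) auto
    also have "\<dots> \<le> J y"
      unfolding J_def set_lebesgue_integral_def
    proof (rule integral_mono')
      show "integrable lborel (\<lambda>u. indicator {0..1} u *\<^sub>R min 1 \<bar>k (y + u) - k y\<bar>)"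
        using int[of 0 1 y y] by (simp add: set_integrable_def add.commute)
    qed (use y in \<open>auto simp: indicator_def\<close>)
    finally show ?thesis .
  qed
  have bound: "min 1 \<bar>k y - k x\<bar> \<le> 2 * (J x + J y)" if y: "y \<in> {x..x+1/2}" for x y
  proof -
    have i: "set_integrable lborel {x+1/2..x+1} (\<lambda>z. min 1 \<bar>k z - k y\<bar>)" for y
      using int[of _ _ 0] by simp
    have "1/2 * min 1 \<bar>k y - k x\<bar> = (LBINT z:{x+1/2..x+1}. min 1 \<bar>k y - k x\<bar>)"
      by (subst set_integral_const) auto
    also have "\<dots> \<le> (LBINT z:{x+1/2..x+1}. min 1 \<bar>k z - k x\<bar> + min 1 \<bar>k z - k y\<bar>)"
      by (intro set_integral_mono set_integral_add i borel_integrable_atLeastAtMost' continuous_on_const) auto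
    also have "\<dots> = (LBINT z:{x+1/2..x+1}. min 1 \<bar>k z - k x\<bar>) + (LBINT z:{x+1/2..x+1}. min 1 \<bar>k z - k y\<bar>)"
      by (intro set_integral_add i)
    also have "\<dots> \<le> J x + J y"
      by (intro add_mono J_ge) (use y in auto)
    finally show ?thesis by simp
  qed
  \<comment> \<open>With this bound \<open>2 * (J x + J y)\<close> lies below
    \<open>min 1 e\<close>; a truncated value smaller than 1 is the value itself, so the truncation
    disappears.\<close>
  obtain X where X: "\<And>x. x \<ge> X \<Longrightarrow> \<bar>J x\<bar> < min 1 e / 4"
    using tendstoD[OF J_lim, of "min 1 e / 4"] \<open>e > 0\<close>
    by (auto simp: eventually_at_top_linorder)
  show ?thesis
  proof (intro exI[of _ "max X b"] allI impI ballI)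
    fix x y assume x: "max X b \<le> x" and y: "y \<in> {x..x + 1/2}"
    have "min 1 \<bar>k y - k x\<bar> < min 1 e"
      using bound[OF y] X[of x] X[of y] x y by auto
    hence "\<bar>k y - k x\<bar> < e" by (auto simp: min_def split: if_splits)
    thus "\<bar>ln (f (exp y)) - ln (f (exp x)) - \<kappa> * (y - x)\<bar> < e"
      using x y by (simp add: k_eq algebra_simps)
  qed
qed

text \<open>If \<open>t\<close> and \<open>t'\<close> differ by a factor of at most
  \<open>1 + \<delta>\<close>, their logarithms differ by at most \<open>\<delta>\<close>, so both
  the main term \<open>\<kappa> * (ln t' - ln t)\<close> and the uniform error are small.\<close>

lemma regularly_varying_near_diagonal:
  assumes rv: "regularly_varying_at_top f \<kappa>" and e: "e > 0"
  shows "\<exists>\<delta>>0. \<exists>T>0. \<forall>t\<ge>T. \<forall>t'\<ge>T. t \<le> (1 + \<delta>) * t' \<and> t' \<le> (1 + \<delta>) * t \<longrightarrow>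
           \<bar>f t' / f t - 1\<bar> < e"
proof -
  obtain a where pos: "\<And>t. t \<ge> a \<Longrightarrow> f t > 0"
    using rv unfolding regularly_varying_at_top_def by blast
  have "isCont exp (0::real)" by simp
  then obtain e1 where e1: "e1 > 0" "\<And>z. \<bar>z\<bar> < e1 \<Longrightarrow> \<bar>exp z - 1\<bar> < (e::real)"
    using e unfolding continuous_at_eps_delta by (force simp: dist_real_def)
  obtain X where X: "\<And>x y. x \<ge> X \<Longrightarrow> y \<in> {x..x + 1/2} \<Longrightarrow>
      \<bar>ln (f (exp y)) - ln (f (exp x)) - \<kappa> * (y - x)\<bar> < e1 / 2"
    using regularly_varying_log_uniform[OF rv half_gt_zero[OF e1(1)]] by blast
  \<comment> \<open>The cap 1/2 keeps \<open>ln t'\<close> in the window of the additive estimate;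
    the other term gives \<open>\<bar>\<kappa>\<bar> * \<delta> < e1 / 2\<close>, with
    \<open>+ 1\<close> avoiding a zero denominator.\<close>
  define \<delta> where "\<delta> = min (1/2) (e1 / (2 * (\<bar>\<kappa>\<bar> + 1)))"
  have \<delta>: "\<delta> > 0" "\<delta> \<le> 1/2" "\<bar>\<kappa>\<bar> * \<delta> < e1 / 2"
  proof -
    show "\<delta> > 0" using e1 by (simp add: \<delta>_def)
    show "\<delta> \<le> 1/2" unfolding \<delta>_def by (rule min.cobounded1)
    have "\<bar>\<kappa>\<bar> * \<delta> \<le> \<bar>\<kappa>\<bar> * (e1 / (2 * (\<bar>\<kappa>\<bar> + 1)))"
      by (intro mult_left_mono) (auto simp: \<delta>_def)
    also have "\<dots> < e1 / 2" using e1 by (simp add: field_simps add_pos_nonneg)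
    finally show "\<bar>\<kappa>\<bar> * \<delta> < e1 / 2" .
  qed
  define T where "T = max (exp X) a"
  have T: "T > 0" by (simp add: T_def less_max_iff_disj)
  have *: "\<bar>ln (f t') - ln (f t)\<bar> < e1" if "t \<ge> T" "t \<le> t'" "t' \<le> (1 + \<delta>) * t" for t t'
  proof -
    have tp: "t > 0" "t' > 0" using T that by auto
    have "ln t' \<le> ln ((1 + \<delta>) * t)" using that tp by (subst ln_le_cancel_iff) auto
    also have "\<dots> = ln (1 + \<delta>) + ln t" using tp \<delta> by (simp add: ln_mult)
    also have "\<dots> \<le> \<delta> + ln t" using ln_add_one_self_le_self[of \<delta>] \<delta> by simp
    finally have l: "ln t' - ln t \<le> \<delta>" by simp
    have l0: "ln t' - ln t \<ge> 0" using that tp by simp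
    have "exp X \<le> t" using that by (simp add: T_def)
    hence "X \<le> ln t" using tp ln_ge_iff by blast
    hence "\<bar>ln (f t') - ln (f t) - \<kappa> * (ln t' - ln t)\<bar> < e1 / 2"
      using X[of "ln t" "ln t'"] l l0 \<delta> tp by auto
    moreover have "\<bar>\<kappa> * (ln t' - ln t)\<bar> \<le> \<bar>\<kappa>\<bar> * \<delta>"
      using l l0 by (auto simp: abs_mult intro!: mult_left_mono)
    ultimately show ?thesis using \<delta> by linarith
  qed
  have "\<bar>f t' / f t - 1\<bar> < e"
    if "t \<ge> T" "t' \<ge> T" "t \<le> (1 + \<delta>) * t'" "t' \<le> (1 + \<delta>) * t" for t t'
  proof -
    have "\<bar>ln (f t') - ln (f t)\<bar> < e1"
      using *[of t t'] *[of t' t] that by (cases "t \<le> t'") auto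
    moreover have "f t > 0" "f t' > 0" using that by (auto intro!: pos simp: T_def)
    ultimately show ?thesis using e1(2)[of "ln (f t') - ln (f t)"]
      by (simp add: exp_diff)
  qed
  thus ?thesis using \<delta>(1) T by blast
qed

lemma regularly_varying_asymp:
  assumes rv: "regularly_varying_at_top f \<kappa>"
    and p: "filterlim p at_top Fl" and q: "((\<lambda>s. q s / p s) \<longlongrightarrow> 1) Fl"
  shows "((\<lambda>s. f (q s) / f (p s)) \<longlongrightarrow> 1) Fl"
proof (rule tendstoI)
  fix e :: real assume "e > 0"
  then obtain \<delta> T where \<delta>: "\<delta> > 0" and T: "T > 0"
    and D: "\<And>t t'. t \<ge> T \<Longrightarrow> t' \<ge> T \<Longrightarrow> t \<le> (1 + \<delta>) * t' \<Longrightarrow> t' \<le> (1 + \<delta>) * t \<Longrightarrow> \<bar>f t' / f t - 1\<bar> < e"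
    using regularly_varying_near_diagonal[OF rv] by metis
  have "1 / (1 + \<delta>) < 1" using \<delta> by simp
  \<comment> \<open>The extra factor \<open>1 + \<delta>\<close> leaves room for
    \<open>q s \<ge> T\<close> as well.\<close>
  have "\<forall>\<^sub>F s in Fl. p s \<ge> (1 + \<delta>) * T"
    using p by (simp add: filterlim_at_top)
  moreover have "\<forall>\<^sub>F s in Fl. q s / p s < 1 + \<delta>"
    using order_tendstoD(2)[OF q] \<delta> by simp
  moreover have "\<forall>\<^sub>F s in Fl. q s / p s > 1 / (1 + \<delta>)"
    using order_tendstoD(1)[OF q] \<open>1 / (1 + \<delta>) < 1\<close> by simp
  ultimately show "\<forall>\<^sub>F s in Fl. dist (f (q s) / f (p s)) 1 < e"
  proof eventually_elim
    case (elim s)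
    have "T \<le> (1 + \<delta>) * T" using \<delta> T by simp
    with elim T have pT: "p s \<ge> T" "p s > 0" by linarith+
    have pq: "p s \<le> (1 + \<delta>) * q s" "q s \<le> (1 + \<delta>) * p s"
      using elim pT \<delta> by (auto simp: field_simps)
    have "(1 + \<delta>) * T \<le> (1 + \<delta>) * q s" using elim(1) pq by linarith
    hence "q s \<ge> T" using \<delta> by simp
    thus ?case using D[OF pT(1) _ pq] by (simp add: dist_real_def)
  qed
qed

text \<open>If \<open>\<kappa> > 1\<close>, then \<open>f (2 * t) > 2 * f t\<close> for large
  \<open>t\<close>, so \<open>f t / t\<close> does not decrease along \<open>T * 2 ^ n\<close> and
  stays above a positive constant.\<close>

lemma regularly_varying_sublinear_index:
  assumes rv: "regularly_varying_at_top f \<kappa>" and lim: "((\<lambda>t. f t / t) \<longlongrightarrow> 0) at_top"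
  shows "\<kappa> \<le> 1"
proof (rule ccontr)
  assume "\<not> \<kappa> \<le> 1"
  hence "2 powr 1 < (2::real) powr \<kappa>" by (subst powr_less_cancel_iff) auto
  hence "2 < (2::real) powr \<kappa>" by simp
  obtain a where pos: "\<And>t. t \<ge> a \<Longrightarrow> f t > 0"
    and "((\<lambda>t. f (t * 2) / f t) \<longlongrightarrow> 2 powr \<kappa>) at_top"
    using rv unfolding regularly_varying_at_top_def by (metis zero_less_numeral)
  from order_tendstoD(1)[OF this(2) \<open>2 < _\<close>]
  obtain T0 where T0: "\<And>t. t \<ge> T0 \<Longrightarrow> f (t * 2) / f t > 2"
    by (auto simp: eventually_at_top_linorder)
  define T where "T = max 1 (max a T0)"
  have T: "T \<ge> 1" "T \<ge> a" "T \<ge> T0" by (auto simp: T_def)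
  have step: "f t / t \<le> f (t * 2) / (t * 2)" if "t \<ge> T" for t
    using T0[of t] pos[of t] that T by (auto simp: field_simps)
  have ge: "T * 2 ^ n \<ge> T" for n :: nat
    using T by (simp add: mult_le_cancel_left1)
  have "f T / T \<le> f (T * 2 ^ n) / (T * 2 ^ n)" for n
  proof (induction n)
    case (Suc n)
    thus ?case using step[OF ge[of n]] by (simp add: mult_ac)
  qed simp
  moreover have "filterlim (\<lambda>n. T * 2 ^ n) at_top sequentially"
    using T by real_asymp
  from filterlim_compose[OF lim this]
  have "(\<lambda>n. f (T * 2 ^ n) / (T * 2 ^ n)) \<longlonglongrightarrow> 0" .
  ultimately have "f T / T \<le> 0"
    by (intro LIMSEQ_le_const) auto
  thus False using pos[of T] T by (simp add: field_simps)
qed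

section \<open>Slow variation and de Haan expansion of a generator near 0\<close>

text \<open>The real-analytic core, free of copulas: \<open>F\<close> is the finite part of the
  generator, \<open>h\<close> stands for \<open>- \<phi>'\<close>, and everything is required only
  on the open interval from 0 to \<open>r\<close>, where \<open>h\<close> is positive.\<close>

locale slow_generator =
  fixes F h \<psi> :: "real \<Rightarrow> real" and \<kappa> r :: real
  assumes r: "0 < r"
    and rv: "regularly_varying_at_top \<psi> \<kappa>"
    and h_antimono: "\<And>u v. 0 < u \<Longrightarrow> u \<le> v \<Longrightarrow> v < r \<Longrightarrow> h v \<le> h u"
    and h_pos: "\<And>u. 0 < u \<Longrightarrow> u < r \<Longrightarrow> 0 < h u"
    and h_int: "\<And>u v. 0 < u \<Longrightarrow> u \<le> v \<Longrightarrow> v < r \<Longrightarrow> set_integrable lborel {u..v} h"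
    and F_diff: "\<And>u v. 0 < u \<Longrightarrow> u \<le> v \<Longrightarrow> v < r \<Longrightarrow> F u - F v = (LBINT w:{u..v}. h w)"
    and F_top: "filterlim F at_top (at_right 0)"
    and \<psi>_F: "\<And>u. 0 < u \<Longrightarrow> u < r \<Longrightarrow> \<psi> (F u) = u * h u"
    and slow: "((\<lambda>u. u * h u / F u) \<longlongrightarrow> 0) (at_right 0)"
begin

lemma F_diff_bounds:
  assumes "0 < u" "u \<le> v" "v < r"
  shows "(v - u) * h v \<le> F u - F v" "F u - F v \<le> (v - u) * h u"
proof -
  have c: "(LBINT w:{u..v}. c) = (v - u) * c" "set_integrable lborel {u..v} (\<lambda>_. c)" for c :: real
    using assms by (simp_all add: set_lebesgue_integral_def set_integrable_def)
  show "(v - u) * h v \<le> F u - F v" "F u - F v \<le> (v - u) * h u"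
    unfolding F_diff[OF assms] c(1)[symmetric] using assms
    by (auto intro!: set_integral_mono c h_int h_antimono)
qed

lemma F_strict_antimono: "0 < u \<Longrightarrow> u < v \<Longrightarrow> v < r \<Longrightarrow> F v < F u"
  using F_diff_bounds(1)[of u v] h_pos[of v] by (smt (verit) mult_pos_pos)

lemma F_less_iff: "0 < u \<Longrightarrow> u < r \<Longrightarrow> 0 < v \<Longrightarrow> v < r \<Longrightarrow> F v < F u \<longleftrightarrow> u < v"
  using F_strict_antimono[of u v] F_strict_antimono[of v u] by (cases u v rule: linorder_cases) auto

text \<open>Since \<open>h\<close> is antimonotone, \<open>h u\<close> is a Lipschitz constant on
  \<open>{u..v}\<close>. Continuity serves the intermediate value theorem in
  \<open>F_surj\<close>.\<close>

lemma F_cont: "continuous_on {u..v} F" if uv: "0 < u" "v < r"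
proof (rule continuous_onI)
  fix x e :: real assume x: "x \<in> {u..v}" and e: "e > 0"
  have hu: "h u > 0" using x uv by (intro h_pos) auto
  have lip: "\<bar>F y - F z\<bar> \<le> \<bar>z - y\<bar> * h u" if yz: "y \<in> {u..v}" "z \<in> {u..v}" "y \<le> z" for y z
  proof -
    have "F y - F z \<le> (z - y) * h y" "0 \<le> F y - F z"
      using F_diff_bounds[of y z] F_less_iff[of y z] yz uv by auto
    moreover have "(z - y) * h y \<le> (z - y) * h u"
      using yz uv by (intro mult_left_mono h_antimono) auto
    ultimately show ?thesis using yz by simp
  qed
  show "\<exists>d>0. \<forall>x'\<in>{u..v}. dist x' x < d \<longrightarrow> dist (F x') (F x) \<le> e"
  proof (intro exI[of _ "e / h u"] conjI ballI impI)
    fix y assume y: "y \<in> {u..v}" "dist y x < e / h u"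
    have "\<bar>F y - F x\<bar> \<le> \<bar>y - x\<bar> * h u"
      using lip[of y x] lip[of x y] x y by (cases "y \<le> x") (auto simp: abs_minus_commute)
    also have "\<dots> \<le> e" using y hu by (simp add: dist_real_def field_simps)
    finally show "dist (F y) (F x) \<le> e" by (simp add: dist_real_def)
  qed (use e hu in auto)
qed

text \<open>The interior point \<open>r / 2\<close> is used because the locale does not control
  \<open>F\<close> at \<open>r\<close>.\<close>

lemma F_surj:
  assumes "t \<ge> F (r / 2)"
  shows "\<exists>s\<in>{0<..<r}. F s = t"
proof -
  have "\<forall>\<^sub>F s in at_right 0. F s \<ge> t \<and> s \<in> {0<..<r/2}"
    using F_top r by (intro eventually_conj eventually_at_right_real) (auto simp: filterlim_at_top)
  then obtain s where s: "F s \<ge> t" "0 < s" "s < r / 2"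
    by (auto dest!: eventually_happens)
  have "\<exists>x\<ge>s. x \<le> r / 2 \<and> F x = t"
    using s assms r by (intro IVT2' F_cont) auto
  thus ?thesis using s r by (auto intro!: bexI)
qed

lemma eventually_scale: "x > 0 \<Longrightarrow> \<forall>\<^sub>F s in at_right 0. 0 < s \<and> s < r \<and> 0 < s * x \<and> s * x < r"
  using r eventually_at_right_real[of 0 "min r (r / x)"]
  by (auto elim!: eventually_mono simp: field_simps)

lemma scale_at_right: "x > 0 \<Longrightarrow> filterlim (\<lambda>s. s * x) (at_right 0) (at_right (0::real))"
  by real_asymp

text \<open>For \<open>x \<ge> 1\<close>, \<open>F s - F (s * x)\<close> lies between 0 and
  \<open>(x - 1) * (s * h s)\<close>, which is negligible against \<open>F s\<close> by
  \<open>slow\<close>. The case \<open>x < 1\<close> is the reciprocal, with factor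
  \<open>1 / x\<close> and base point \<open>s * x\<close>.\<close>

lemma F_scale_ratio:
  assumes x: "x > 0"
  shows "((\<lambda>s. F (s * x) / F s) \<longlongrightarrow> 1) (at_right 0)"
proof -
  have ge1: "((\<lambda>s. F (s * x) / F s) \<longlongrightarrow> 1) (at_right 0)" if x: "x \<ge> 1" for x
  proof (rule tendsto_sandwich)
    have "((\<lambda>s. 1 - (x - 1) * (s * h s / F s)) \<longlongrightarrow> 1 - (x - 1) * 0) (at_right 0)"
      by (intro tendsto_intros slow)
    thus "((\<lambda>s. 1 - (x - 1) * (s * h s / F s)) \<longlongrightarrow> 1) (at_right 0)" by simp
    have ev: "\<forall>\<^sub>F s in at_right 0. F s > 0" using F_top by (simp add: filterlim_at_top_dense)
    have "x > 0" using x by simp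
    show "\<forall>\<^sub>F s in at_right 0. 1 - (x - 1) * (s * h s / F s) \<le> F (s * x) / F s"
      using ev eventually_scale[OF \<open>x > 0\<close>]
    proof eventually_elim
      case (elim s)
      have "F s - F (s * x) \<le> (x - 1) * (s * h s)"
        using F_diff_bounds(2)[of s "s * x"] elim x by (auto simp: algebra_simps)
      hence "(F s - F (s * x)) / F s \<le> (x - 1) * (s * h s) / F s"
        using elim by (intro divide_right_mono) auto
      thus ?case using elim by (simp add: diff_divide_distrib)
    qed
    show "\<forall>\<^sub>F s in at_right 0. F (s * x) / F s \<le> 1"
      using ev eventually_scale[OF \<open>x > 0\<close>]
    proof eventually_elim
      case (elim s)
      have "F (s * x) \<le> F s"
        using F_strict_antimono[of s "s * x"] elim x by (cases "x = 1") auto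
      thus ?case using elim by (simp add: field_simps)
    qed
  qed simp
  show ?thesis
  proof (cases "x \<ge> 1")
    case False
    have "((\<lambda>s. inverse (F (s * x * (1 / x)) / F (s * x))) \<longlongrightarrow> inverse 1) (at_right 0)"
      using x False by (intro tendsto_inverse filterlim_compose[OF ge1 scale_at_right]) auto
    thus ?thesis using x by simp
  qed (rule ge1)
qed

text \<open>The function \<open>F\<close> lies in de Haan's class \<open>\<Pi>\<close> at 0, with auxiliary function \<open>\<psi> \<circ> F\<close>.\<close>

lemma F_de_Haan:
  assumes x: "x > 0"
  shows "((\<lambda>s. (F (s * x) - F s) / \<psi> (F s)) \<longlongrightarrow> - ln x) (at_right 0)"
proof -
  have ge1: "((\<lambda>s. (F (s * x) - F s) / \<psi> (F s)) \<longlongrightarrow> - ln x) (at_right 0)" if x: "x \<ge> 1" for x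
  proof (rule tendstoI)
    fix e :: real assume e: "e > 0"
    \<comment> \<open>The summand 1 covers \<open>x = 1\<close>, where \<open>ln x\<close>
      vanishes.\<close>
    define e' where "e' = e / (ln x + 1)"
    have e': "e' > 0" "e' * ln x < e"
    proof -
      have "ln x + 1 > 0" using x by (simp add: add_nonneg_pos)
      thus "e' > 0" "e' * ln x < e" using e by (simp_all add: e'_def field_simps)
    qed
    obtain \<delta> T where \<delta>: "\<delta> > 0" "T > 0" and D: "\<And>t t'. t \<ge> T \<Longrightarrow> t' \<ge> T \<Longrightarrow>
        t \<le> (1 + \<delta>) * t' \<Longrightarrow> t' \<le> (1 + \<delta>) * t \<Longrightarrow> \<bar>\<psi> t' / \<psi> t - 1\<bar> < e'"
      using regularly_varying_near_diagonal[OF rv e'(1)] by metis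
    have "filterlim (\<lambda>s. F (s * x)) at_top (at_right 0)"
      using x by (intro filterlim_compose[OF F_top scale_at_right]) auto
    hence "\<forall>\<^sub>F s in at_right 0. F (s * x) \<ge> T" by (simp add: filterlim_at_top)
    moreover have "\<forall>\<^sub>F s in at_right 0. F (s * x) / F s > 1 / (1 + \<delta>)"
      using order_tendstoD(1)[OF F_scale_ratio, of x "1 / (1 + \<delta>)"] x \<delta> by simp
    moreover have "\<forall>\<^sub>F s in at_right 0. 0 < s \<and> s < r \<and> 0 < s * x \<and> s * x < r"
      using x by (intro eventually_scale) auto
    ultimately show "\<forall>\<^sub>F s in at_right 0. dist ((F (s * x) - F s) / \<psi> (F s)) (- ln x) < e"
    proof eventually_elim
      case (elim s)
      have anti: "F v \<le> F u" if "0 < u" "u \<le> v" "v < r" for u v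
        using F_strict_antimono[of u v] that by (cases "u = v") auto
      have sx: "s \<le> s * x" using x elim by simp
      define p where "p = \<psi> (F s)"
      have p: "p > 0" using elim h_pos[of s] by (simp add: p_def \<psi>_F)
      have Fs: "F s \<le> (1 + \<delta>) * F (s * x)" "F s > 0"
        using elim \<delta> anti[of s "s * x"] sx by (auto simp: field_simps)
      \<comment> \<open>\<open>F u\<close> is trapped between \<open>F (s * x)\<close> and
        \<open>F s\<close>, which are within a factor \<open>1 + \<delta>\<close> of each other.
        Hence one \<open>\<delta>\<close> controls \<open>\<psi> (F u) = u * h u\<close> for all
        \<open>u\<close> at once, and \<open>h u\<close> equals \<open>p / u\<close> up to relative
        error \<open>e'\<close>.\<close>
      have hb: "\<bar>h u - p / u\<bar> \<le> e' * p / u" if u: "u \<in> {s..s*x}" for u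
      proof -
        have u0: "0 < u" "u < r" using u elim by auto
        have 1: "F (s * x) \<le> F u" "F u \<le> F s"
          using u elim by (auto intro!: anti)
        have "(1 + \<delta>) * F (s * x) \<le> (1 + \<delta>) * F u"
          using 1 \<delta> by (intro mult_left_mono) auto
        moreover have "F s \<le> (1 + \<delta>) * F s" using \<delta> Fs by simp
        ultimately have "F s \<le> (1 + \<delta>) * F u" "F u \<le> (1 + \<delta>) * F s" "T \<le> F s" "T \<le> F u"
          using 1 Fs elim by linarith+
        hence "\<bar>\<psi> (F u) / p - 1\<bar> < e'"
          unfolding p_def by (intro D)
        hence "\<bar>u * h u / p - 1\<bar> < e'" using u0 by (simp add: \<psi>_F)
        moreover have "h u - p / u = (u * h u / p - 1) * (p / u)"
          using p u0 by (simp add: field_simps)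
        ultimately have "\<bar>h u - p / u\<bar> \<le> e' * (p / u)"
          unfolding abs_mult using p u0 by (metis abs_mult abs_of_pos divide_pos_pos less_imp_le mult_right_mono)
        thus ?thesis by simp
      qed
      have c: "continuous_on {s..s*x} (\<lambda>u. 1 / u)"
        using elim by (intro continuous_intros) auto
      have Li: "set_integrable lborel {s..s*x} (\<lambda>u. c * (1 / u))" for c
        by (intro set_integrable_mult_right borel_integrable_atLeastAtMost' c)
      have "(LBINT u:{s..s*x}. 1 / u) = ln (s * x) - ln s"
        unfolding set_lebesgue_integral_def
      proof (rule integral_FTC_atLeastAtMost[OF sx _ c])
        fix u assume "s \<le> u" "u \<le> s * x"
        thus "(ln has_vector_derivative 1 / u) (at u within {s..s * x})"
          using elim unfolding has_real_derivative_iff_has_vector_derivative[symmetric]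
          by (auto intro!: derivative_eq_intros)
      qed
      hence L: "(LBINT u:{s..s*x}. c * (1 / u)) = c * ln x" for c
        unfolding set_integral_mult_right using elim x by (simp add: ln_mult)
      \<comment> \<open>Integrating the two-sided bound \<open>hb\<close> turns \<open>p / u\<close>
        into \<open>p * ln x\<close>.\<close>
      have "(LBINT u:{s..s*x}. h u) \<le> (LBINT u:{s..s*x}. (p + e' * p) * (1 / u))"
        using elim sx hb by (intro set_integral_mono Li h_int) (auto simp: abs_le_iff field_simps)
      moreover have "(LBINT u:{s..s*x}. (p - e' * p) * (1 / u)) \<le> (LBINT u:{s..s*x}. h u)"
        using elim sx hb by (intro set_integral_mono Li h_int) (auto simp: abs_le_iff field_simps)
      ultimately have "\<bar>F s - F (s * x) - p * ln x\<bar> \<le> p * (e' * ln x)"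
        using F_diff[of s "s * x"] elim sx unfolding L by (auto simp: abs_le_iff algebra_simps)
      also have "\<dots> < p * e" using p e' by simp
      finally have "\<bar>(F s - F (s * x) - p * ln x) / p\<bar> < e" using p by (simp add: field_simps)
      also have "(F s - F (s * x) - p * ln x) / p = - ((F (s * x) - F s) / p - (- ln x))"
        using p by (simp add: field_simps)
      finally show ?case unfolding dist_real_def p_def abs_minus_cancel .
    qed
  qed
  show ?thesis
  proof (cases "x \<ge> 1")
    case False
    \<comment> \<open>The roles of \<open>s\<close> and \<open>s * x\<close> are exchanged; the
      change of normalisation from \<open>\<psi> (F (s * x))\<close> to \<open>\<psi> (F s)\<close>
      costs a factor tending to 1, because \<open>F (s * x)\<close> and \<open>F s\<close> are
      asymptotically equal.\<close>
    have "((\<lambda>s. - ((F (s * x * (1 / x)) - F (s * x)) / \<psi> (F (s * x))) * (\<psi> (F (s * x)) / \<psi> (F s)))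
            \<longlongrightarrow> - (- ln (1 / x)) * 1) (at_right 0)"
      using x False
      by (intro tendsto_mult tendsto_minus filterlim_compose[OF ge1 scale_at_right]
          regularly_varying_asymp[OF rv F_top] F_scale_ratio) auto
    moreover have "\<forall>\<^sub>F s in at_right 0.
        - ((F (s * x * (1 / x)) - F (s * x)) / \<psi> (F (s * x))) * (\<psi> (F (s * x)) / \<psi> (F s))
        = (F (s * x) - F s) / \<psi> (F s)"
      using eventually_scale[OF x]
    proof eventually_elim
      case (elim s)
      hence "\<psi> (F (s * x)) > 0" "\<psi> (F s) > 0" using h_pos by (simp_all add: \<psi>_F x)
      thus ?case using x by (simp add: field_simps)
    qed
    ultimately show ?thesis using x by (simp add: tendsto_cong ln_div)
  qed (rule ge1)
qed

end

section \<open>Inverting the expansion\<close>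

locale slow_generator_inverse = slow_generator +
  fixes G :: "real \<Rightarrow> real"
  assumes G_F: "\<And>s. 0 < s \<Longrightarrow> s < r \<Longrightarrow> G (F s) = s"
begin

text \<open>\<open>G\<close> is assumed to be only a left inverse; surjectivity of \<open>F\<close>
  onto large values makes it two-sided there.\<close>

lemma F_G:
  assumes "t \<ge> F (r / 2)"
  shows "0 < G t" "G t < r" "F (G t) = t"
  using F_surj[OF assms] G_F by auto

lemma G_at_right: "filterlim G (at_right 0) at_top"
proof -
  have ev: "\<forall>\<^sub>F t in at_top. G t < e" if "e > 0" for e
  proof -
    define e' where "e' = min e r / 2"
    have e': "0 < e'" "e' < e" "e' < r" using that r by (auto simp: e'_def min_def)
    show ?thesis
      using eventually_gt_at_top[of "F e'"] eventually_ge_at_top[of "F (r / 2)"]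
    proof eventually_elim
      case (elim t)
      thus ?case using F_strict_antimono[of e' "G t"] F_G[of t] e'
        by (cases "G t \<le> e'") auto
    qed
  qed
  have pos: "\<forall>\<^sub>F t in at_top. 0 < G t"
    using eventually_ge_at_top[of "F (r / 2)"] by eventually_elim (rule F_G)
  have "(G \<longlongrightarrow> 0) at_top"
  proof (rule order_tendstoI)
    show "\<forall>\<^sub>F t in at_top. c < G t" if "c < 0" for c
      using pos by eventually_elim (use that in auto)
  qed (rule ev)
  thus ?thesis using pos by (auto simp: filterlim_at intro: eventually_mono)
qed

text \<open>Substituting \<open>u = G t\<close> turns \<open>slow\<close> into
  \<open>\<psi> t / t\<close> tending to 0.\<close>

lemma index_le_1: "\<kappa> \<le> 1"
proof (rule regularly_varying_sublinear_index[OF rv])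
  have "((\<lambda>t. G t * h (G t) / F (G t)) \<longlongrightarrow> 0) at_top"
    by (rule filterlim_compose[OF slow G_at_right])
  moreover have "\<forall>\<^sub>F t in at_top. G t * h (G t) / F (G t) = \<psi> t / t"
    using eventually_ge_at_top[of "F (r / 2)"]
    by eventually_elim (metis F_G \<psi>_F)
  ultimately show "((\<lambda>t. \<psi> t / t) \<longlongrightarrow> 0) at_top" by (simp add: tendsto_cong)
qed

text \<open>Moving the argument from \<open>T\<close> by about \<open>- v * \<psi> T\<close>
  multiplies \<open>G\<close> by about \<open>exp v\<close>. To compare \<open>G w\<close> with
  \<open>x * G T\<close>, apply the decreasing \<open>F\<close>: the sign of
  \<open>F (G T * x) - w\<close> is eventually that of \<open>v - ln x\<close>.\<close>

lemma G_perturb: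
  assumes T: "filterlim T at_top Fl" and v: "((\<lambda>s. (w s - T s) / \<psi> (T s)) \<longlongrightarrow> - v) Fl"
    and w: "filterlim w at_top Fl"
  shows "((\<lambda>s. G (w s) / G (T s)) \<longlongrightarrow> exp v) Fl"
proof -
  have \<sigma>: "filterlim (\<lambda>s. G (T s)) (at_right 0) Fl"
    by (rule filterlim_compose[OF G_at_right T])
  have evT: "\<forall>\<^sub>F s in Fl. T s \<ge> F (r / 2)" "\<forall>\<^sub>F s in Fl. w s \<ge> F (r / 2)"
    using T w by (simp_all add: filterlim_at_top)
  have lim: "((\<lambda>s. (F (G (T s) * x) - T s) / \<psi> (T s)) \<longlongrightarrow> - ln x) Fl" if "x > 0" for x
  proof -
    have "((\<lambda>s. (F (G (T s) * x) - F (G (T s))) / \<psi> (F (G (T s)))) \<longlongrightarrow> - ln x) Fl"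
      by (rule filterlim_compose[OF F_de_Haan[OF that] \<sigma>])
    moreover have "\<forall>\<^sub>F s in Fl. (F (G (T s) * x) - F (G (T s))) / \<psi> (F (G (T s)))
        = (F (G (T s) * x) - T s) / \<psi> (T s)"
      using evT(1) by eventually_elim (simp add: F_G)
    ultimately show ?thesis by (simp add: tendsto_cong)
  qed
  have diff: "((\<lambda>s. (F (G (T s) * x) - w s) / \<psi> (T s)) \<longlongrightarrow> v - ln x) Fl" if "x > 0" for x
    using tendsto_diff[OF lim[OF that] v] by (simp add: diff_divide_distrib)
  have ev\<sigma>: "\<forall>\<^sub>F s in Fl. G (T s) < r \<and> 0 < G (T s) * x \<and> G (T s) * x < r" if "x > 0" for x
    using filterlim_iff[THEN iffD1, OF \<sigma>, rule_format, OF eventually_scale[OF that]]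
    by eventually_elim auto
  have pos: "\<forall>\<^sub>F s in Fl. \<psi> (T s) > 0"
    using evT(1)
  proof eventually_elim
    case (elim s)
    thus ?case using F_G[OF elim] \<psi>_F[of "G (T s)"] h_pos[of "G (T s)"] by simp
  qed
  show ?thesis
  proof (rule order_tendstoI)
    fix x assume x: "exp v < x"
    hence x0: "x > 0" by (rule less_trans[OF exp_gt_zero])
    hence "v - ln x < 0" using x by (metis diff_less_0_iff_less exp_less_cancel_iff exp_ln)
    from order_tendstoD(2)[OF diff[OF x0] this] pos evT ev\<sigma>[OF x0]
    show "\<forall>\<^sub>F s in Fl. G (w s) / G (T s) < x"
    proof eventually_elim
      case (elim s)
      have "F (G (T s) * x) < F (G (w s))"
        using elim F_G(3)[of "w s"] by (simp add: divide_less_0_iff)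
      hence "G (w s) < G (T s) * x"
        using F_less_iff[of "G (w s)" "G (T s) * x"] F_G[of "w s"] elim by simp
      thus ?case using F_G(1)[of "T s"] elim by (simp add: field_simps)
    qed
  next
    fix x assume x: "x < exp v"
    show "\<forall>\<^sub>F s in Fl. x < G (w s) / G (T s)"
    proof (cases "x > 0")
      case x0: True
      hence "0 < v - ln x" using x by (metis diff_gt_0_iff_gt exp_less_cancel_iff exp_ln)
      from order_tendstoD(1)[OF diff[OF x0] this] pos evT ev\<sigma>[OF x0]
      show ?thesis
      proof eventually_elim
        case (elim s)
        have "F (G (w s)) < F (G (T s) * x)"
          using elim F_G(3)[of "w s"] by (simp add: zero_less_divide_iff)
        hence "G (T s) * x < G (w s)"
          using F_less_iff[of "G (T s) * x" "G (w s)"] F_G[of "w s"] elim by simp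
        thus ?case using F_G(1)[of "T s"] elim by (simp add: field_simps)
      qed
    next
      case False
      show ?thesis using evT
      proof eventually_elim
        case (elim s)
        hence "0 < G (w s) / G (T s)" by (simp add: F_G)
        thus ?case using False by linarith
      qed
    qed
  qed
qed

text \<open>The expansions of the \<open>F (s * x i)\<close> add up to \<open>m * F s\<close> minus
  \<open>\<psi> (F s)\<close> times the sum of the logarithms, up to smaller terms. Renormalising by
  \<open>\<psi> (m * F s)\<close> produces the factor \<open>m powr (- \<kappa>)\<close>, and
  \<open>G_perturb\<close> at \<open>T = m * F s\<close> exponentiates.\<close>

lemma G_sum_scale:
  fixes I :: "'i set"
  assumes I: "finite I" "I \<noteq> {}" and x: "\<And>i. i \<in> I \<Longrightarrow> x i > 0"
  shows "((\<lambda>s. G (\<Sum>i\<in>I. F (s * x i)) / G (card I * F s))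
           \<longlongrightarrow> (\<Prod>i\<in>I. x i powr (card I powr (- \<kappa>)))) (at_right 0)"
proof -
  define m where "m = real (card I)"
  have m: "m > 0" using I by (simp add: m_def card_gt_0_iff)
  have T: "filterlim (\<lambda>s. m * F s) at_top (at_right 0)"
    using m by (intro filterlim_tendsto_pos_mult_at_top[OF tendsto_const] F_top)
  have "((\<lambda>t. \<psi> (t * m) / \<psi> t) \<longlongrightarrow> m powr \<kappa>) at_top"
    using rv m by (auto simp: regularly_varying_at_top_def)
  from filterlim_compose[OF this F_top]
  have "((\<lambda>s. \<psi> (F s * m) / \<psi> (F s)) \<longlongrightarrow> m powr \<kappa>) (at_right 0)" .
  hence \<psi>m: "((\<lambda>s. \<psi> (F s) / \<psi> (m * F s)) \<longlongrightarrow> m powr (- \<kappa>)) (at_right 0)"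
    using tendsto_inverse[of _ "m powr \<kappa>"] m by (fastforce simp: powr_minus mult.commute)
  have "((\<lambda>s. (\<Sum>i\<in>I. (F (s * x i) - F s) / \<psi> (F s)) * (\<psi> (F s) / \<psi> (m * F s)))
          \<longlongrightarrow> (\<Sum>i\<in>I. - ln (x i)) * m powr (- \<kappa>)) (at_right 0)"
    by (intro tendsto_mult tendsto_sum F_de_Haan x \<psi>m)
  moreover have "\<forall>\<^sub>F s in at_right 0. (\<Sum>i\<in>I. (F (s * x i) - F s) / \<psi> (F s)) * (\<psi> (F s) / \<psi> (m * F s))
      = ((\<Sum>i\<in>I. F (s * x i)) - m * F s) / \<psi> (m * F s)"
    using eventually_scale[of 1, simplified]
  proof eventually_elim
    case (elim s)
    hence "\<psi> (F s) > 0" using h_pos by (simp add: \<psi>_F)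
    thus ?case by (simp add: sum_divide_distrib[symmetric] sum_subtractf m_def)
  qed
  ultimately have "((\<lambda>s. ((\<Sum>i\<in>I. F (s * x i)) - m * F s) / \<psi> (m * F s))
      \<longlongrightarrow> (\<Sum>i\<in>I. - ln (x i)) * m powr (- \<kappa>)) (at_right 0)"
    by (rule Lim_transform_eventually)
  hence v: "((\<lambda>s. ((\<Sum>i\<in>I. F (s * x i)) - m * F s) / \<psi> (m * F s))
      \<longlongrightarrow> - ((\<Sum>i\<in>I. ln (x i)) * m powr (- \<kappa>))) (at_right 0)"
    by (simp add: sum_negf)
  have w: "filterlim (\<lambda>s. \<Sum>i\<in>I. F (s * x i)) at_top (at_right 0)"
  proof -
    have "filterlim (\<lambda>s. F (s * x i)) at_top (at_right 0)" if "i \<in> I" for i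
      by (rule filterlim_compose[OF F_top scale_at_right[OF x[OF that]]])
    with I show ?thesis
    proof (induction I rule: finite_ne_induct)
      case (insert i J)
      thus ?case by (auto intro!: filterlim_at_top_add_at_top)
    qed simp
  qed
  have "(\<Prod>i\<in>I. x i powr (m powr (- \<kappa>))) = exp ((\<Sum>i\<in>I. ln (x i)) * m powr (- \<kappa>))"
    unfolding sum_distrib_right exp_sum[OF I(1)]
    using x by (intro prod.cong refl) (metis mult.commute order_less_irrefl powr_def)
  thus ?thesis
    using G_perturb[OF T v w] by (simp add: m_def)
qed

end

section \<open>Margins of the copula and the generalized inverse\<close>

text \<open>The value 1 of \<open>C\<close> at the upper corner forces every coordinate to be at
  most 1 almost surely, so imposing the bound 1 outside \<open>I\<close> does not change the
  probability.\<close>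

lemma has_df_on_cube_margin:
  assumes df: "has_df_on_cube d M U C" and C1: "C (\<lambda>_. 1) = 1"
    and I: "I \<subseteq> {1..d}" and x: "\<And>i. i \<in> I \<Longrightarrow> x i \<in> {0..1}"
  shows "\<P>(\<omega> in M. \<forall>i\<in>I. U i \<omega> \<le> x i) = C (\<lambda>i. if i \<in> I then x i else 1)"
proof -
  interpret prob_space M using df by (simp add: has_df_on_cube_def)
  have [measurable]: "U i \<in> borel_measurable M" if "i \<in> {1..d}" for i
    using df that by (simp add: has_df_on_cube_def)
  have C: "\<P>(\<omega> in M. \<forall>i\<in>{1..d}. U i \<omega> \<le> u i) = C u" if "\<And>i. u i \<in> {0..1}" for u
    using df that by (simp add: has_df_on_cube_def)
  have m: "Measurable.pred M (\<lambda>\<omega>. \<forall>i\<in>J. U i \<omega> \<le> u i)" if "J \<subseteq> {1..d}" for J and u :: "nat \<Rightarrow> real"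
    using that finite_subset[OF that] by (intro pred_intros_finite) auto
  have "\<P>(\<omega> in M. \<forall>i\<in>{1..d}. U i \<omega> \<le> 1) = 1"
    using C[of "\<lambda>_. 1"] C1 by simp
  hence "AE \<omega> in M. \<forall>i\<in>{1..d}. U i \<omega> \<le> 1"
    using m[OF subset_refl, of "\<lambda>_. 1"] by (subst (asm) prob_Collect_eq_1) auto
  hence "\<P>(\<omega> in M. \<forall>i\<in>I. U i \<omega> \<le> x i) = \<P>(\<omega> in M. \<forall>i\<in>{1..d}. U i \<omega> \<le> (if i \<in> I then x i else 1))"
    using m[OF I, of x] m[OF subset_refl, of "\<lambda>i. if i \<in> I then x i else 1"]
    by (intro finite_measure_eq_AE) (use I in \<open>auto split: if_splits\<close>)
  also have "\<dots> = C (\<lambda>i. if i \<in> I then x i else 1)"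
    using x by (intro C) auto
  finally show ?thesis .
qed

lemma archimedean_copula_margin:
  assumes "\<phi> 1 = 0" "I \<subseteq> {1..d}"
  shows "archimedean_copula d \<phi> (\<lambda>i. if i \<in> I then x i else 1) = gen_inverse \<phi> (\<Sum>i\<in>I. \<phi> (x i))"
proof -
  have "(\<Sum>i\<in>{1..d}. \<phi> (if i \<in> I then x i else 1)) = (\<Sum>i\<in>I. \<phi> (x i))"
    using assms by (intro sum.mono_neutral_cong_right) auto
  thus ?thesis by (simp add: archimedean_copula_def)
qed

lemma measure_uniform_01_atMost:
  assumes "u \<in> {0..1}"
  shows "measure (uniform_measure lborel {0<..<1::real}) {..u} = u"
proof -
  have "{0<..<1} \<inter> {..u} = (if u = 1 then {0<..<1} else {0<..u})"
    using assms by auto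
  thus ?thesis using assms by (subst measure_uniform_measure) auto
qed

text \<open>Both facts come from the uniform margins. For the second, put \<open>u\<close> in the
  first coordinate and 1 elsewhere: the copula formula collapses to
  \<open>gen_inverse \<phi> (\<phi> u)\<close>, while the probability is \<open>u\<close>.\<close>

lemma
  assumes cop: "is_copula d (archimedean_copula d \<phi>)" and d: "d \<ge> 1" and \<phi>1: "\<phi> 1 = 0"
  shows archimedean_copula_one: "archimedean_copula d \<phi> (\<lambda>_. 1) = 1"
    and gen_inverse_copula: "u \<in> {0..1} \<Longrightarrow> gen_inverse \<phi> (\<phi> u) = u"
proof -
  obtain \<mu> where df: "has_df_on_cube d \<mu> (\<lambda>i x. x i) (archimedean_copula d \<phi>)"
    and unif: "\<And>i. i \<in> {1..d} \<Longrightarrow> distr \<mu> borel (\<lambda>x. x i) = uniform_measure lborel {0<..<1}"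
    using cop unfolding is_copula_def by blast
  interpret prob_space \<mu> using df by (simp add: has_df_on_cube_def)
  have meas [measurable]: "(\<lambda>x. x i) \<in> borel_measurable \<mu>" if "i \<in> {1..d}" for i
    using df that by (simp add: has_df_on_cube_def)
  have P: "\<P>(x in \<mu>. x i \<le> u) = u" if i: "i \<in> {1..d}" and u: "u \<in> {0..1}" for i u
  proof -
    have "measure (distr \<mu> borel (\<lambda>x. x i)) {..u} = measure \<mu> ((\<lambda>x. x i) -` {..u} \<inter> space \<mu>)"
      by (rule measure_distr) (use i in auto)
    also have "(\<lambda>x. x i) -` {..u} \<inter> space \<mu> = {x \<in> space \<mu>. x i \<le> u}" by auto
    finally show ?thesis using unif[OF i] measure_uniform_01_atMost[OF u] by simp
  qed
  have "AE x in \<mu>. x i \<le> 1" if "i \<in> {1..d}" for i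
    using P[OF that, of 1] that by (subst prob_Collect_eq_1[symmetric]) auto
  hence "AE x in \<mu>. \<forall>i\<in>{1..d}. x i \<le> 1" by (intro AE_finite_allI) auto
  hence "\<P>(x in \<mu>. \<forall>i\<in>{1..d}. x i \<le> 1) = 1"
    by (subst prob_Collect_eq_1) (auto intro!: pred_intros_finite)
  moreover have "\<P>(x in \<mu>. \<forall>i\<in>{1..d}. x i \<le> 1) = archimedean_copula d \<phi> (\<lambda>_. 1)"
    using df unfolding has_df_on_cube_def by (auto dest!: spec[of _ "\<lambda>_. 1"])
  ultimately show one: "archimedean_copula d \<phi> (\<lambda>_. 1) = 1" by simp
  show "gen_inverse \<phi> (\<phi> u) = u" if u: "u \<in> {0..1}"
  proof -
    have "u = \<P>(x in \<mu>. \<forall>i\<in>{1}. x i \<le> u)" using P[of 1 u] u d by simp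
    also have "\<dots> = archimedean_copula d \<phi> (\<lambda>i. if i \<in> {1} then u else 1)"
      by (rule has_df_on_cube_margin[OF df one]) (use u d in auto)
    also have "\<dots> = gen_inverse \<phi> (\<Sum>i\<in>{1::nat}. \<phi> u)"
      by (rule archimedean_copula_margin) (use \<phi>1 d in auto)
    finally show ?thesis by simp
  qed
qed

lemma gen_inverse_le: "t \<in> {0..1} \<Longrightarrow> \<phi> t \<le> y \<Longrightarrow> gen_inverse \<phi> y \<le> t"
  unfolding gen_inverse_def by (intro cInf_lower bdd_belowI[of _ 0]) auto

lemma gen_inverse_nonneg:
  assumes "\<phi> 1 = 0"
  shows "gen_inverse \<phi> y \<ge> 0"
proof -
  have "1 \<in> {t \<in> {0..1}. \<phi> t \<le> y}" using assms by simp
  thus ?thesis unfolding gen_inverse_def by (intro cInf_greatest) auto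
qed

section \<open>Reduction of the copula limit to the analytic one\<close>

theorem theorem3p3:
  fixes d :: nat
    and \<phi> :: "real \<Rightarrow> ennreal"
    and \<phi>' :: "real \<Rightarrow> real"
    and M :: "'w measure"
    and U :: "nat \<Rightarrow> 'w \<Rightarrow> real"
    and \<kappa> :: real
  assumes "d \<ge> 2"
    and "archimedean_generator \<phi>"
    and "is_copula d (archimedean_copula d \<phi>)"
    and "monotone_RN_derivative \<phi> \<phi>'"
    and "has_df_on_cube d M U (archimedean_copula d \<phi>)"
    and "\<phi> 0 = \<infinity>"
    and "((\<lambda>s. s * \<phi>' s / enn2real (\<phi> s)) \<longlongrightarrow> 0) (at_right 0)"
    and "regularly_varying_at_top (psi \<phi> \<phi>') \<kappa>"
  shows "\<kappa> \<le> 1 \<and>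
    (\<forall>I x. I \<noteq> {} \<and> I \<subseteq> {1..d} \<and> (\<forall>i\<in>I. x i > 0) \<longrightarrow>
       ((\<lambda>s. 1 / gen_inverse \<phi> (of_nat (card I) * \<phi> s) *
              \<P>(\<omega> in M. \<forall>i\<in>I. U i \<omega> \<le> s * x i))
         \<longlongrightarrow> (\<Prod>i\<in>I. x i powr (real (card I) powr (- \<kappa>)))) (at_right 0))"
proof -
  have \<phi>1: "\<phi> 1 = 0" using assms(2) by (simp add: archimedean_generator_def)
  have d: "d \<ge> 1" using assms(1) by simp
  note inv = gen_inverse_copula[OF assms(3) d \<phi>1]
  \<comment> \<open>The definition of a generator gives only weak monotonicity. Strictness comes
    from the inverse: \<open>\<phi> u \<le> \<phi> v\<close> with \<open>u < v\<close> would put the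
    infimum \<open>gen_inverse \<phi> (\<phi> v) = v\<close> at or below \<open>u\<close>.\<close>
  have strict: "\<phi> v < \<phi> u" if "0 \<le> u" "u < v" "v \<le> 1" for u v
  proof (rule ccontr)
    assume "\<not> \<phi> v < \<phi> u"
    hence "gen_inverse \<phi> (\<phi> v) \<le> u" using that by (intro gen_inverse_le) auto
    thus False using inv[of v] that by simp
  qed
  define F where "F s = enn2real (\<phi> s)" for s
  define G where "G t = gen_inverse \<phi> (ennreal t)" for t
  \<comment> \<open>Finiteness on \<open>(0, 1]\<close> follows from strict decrease below
    \<open>\<phi> 0 = \<infinity>\<close>.\<close>
  have \<phi>_F: "\<phi> s = ennreal (F s)" if "0 < s" "s \<le> 1" for s
    using strict[of 0 s] that assms(6) by (simp add: F_def less_top)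
  have F_nonneg: "F s \<ge> 0" for s by (simp add: F_def)
  have G_F: "G (F s) = s" if "0 < s" "s \<le> 1" for s
    using inv[of s] that by (simp add: G_def \<phi>_F[symmetric])
  have psi_G: "psi \<phi> \<phi>' t = - G t * \<phi>' (G t)" for t by (simp add: psi_eq G_def)
  obtain a where pos: "\<And>t. t \<ge> a \<Longrightarrow> psi \<phi> \<phi>' t > 0"
    using assms(8) unfolding regularly_varying_at_top_def by blast
  \<comment> \<open>\<open>\<phi> 0 = \<infinity>\<close> alone would allow a jump at 0. Positivity
    of \<open>psi\<close> at large \<open>t\<close> forces \<open>G t \<noteq> 0\<close>, and every
    \<open>s\<close> below \<open>G t\<close> has \<open>\<phi> s > t\<close>.\<close>
  have F_top: "filterlim F at_top (at_right 0)"
    unfolding filterlim_at_top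
  proof
    fix Z :: real
    define t where "t = max a (max Z 0)"
    have "G t \<noteq> 0" using pos[of t] by (auto simp: psi_G t_def)
    hence "G t > 0" using gen_inverse_nonneg[of \<phi> "ennreal t"] \<phi>1 by (simp add: G_def order_less_le)
    hence "\<forall>\<^sub>F s in at_right 0. s \<in> {0<..<min 1 (G t)}" by (intro eventually_at_right_real) simp
    thus "\<forall>\<^sub>F s in at_right 0. Z \<le> F s"
    proof eventually_elim
      case (elim s)
      hence "\<not> \<phi> s \<le> ennreal t" using gen_inverse_le[of s \<phi> "ennreal t"] by (auto simp: G_def)
      hence "ennreal t < ennreal (F s)" using \<phi>_F[of s] elim by auto
      thus ?case by (simp add: ennreal_less_iff t_def)
    qed
  qed
  obtain b where b: "b > 0" "\<And>s. 0 < s \<Longrightarrow> s < b \<Longrightarrow> F s \<ge> a"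
    using F_top by (auto simp: filterlim_at_top eventually_at_right_field)
  \<comment> \<open>Below \<open>b\<close> the value \<open>F u\<close> reaches the range where
    \<open>psi\<close> is positive, which makes \<open>- \<phi>' u\<close> positive; the cap 1 stays
    inside the unit interval.\<close>
  define r where "r = min b 1"
  have rb: "0 < r" "r \<le> 1" "r \<le> b" using b by (auto simp: r_def)
  have mono: "mono_on {0<..<1} \<phi>'"
    and RN: "\<And>s t. 0 < s \<Longrightarrow> s \<le> t \<Longrightarrow> t \<le> 1 \<Longrightarrow>
      set_integrable lborel {s..t} \<phi>' \<and> F t - F s = (LBINT u:{s..t}. \<phi>' u)"
    using assms(4) by (auto simp: monotone_RN_derivative_def F_def)
  have psi_F: "psi \<phi> \<phi>' (F u) = u * - \<phi>' u" if "0 < u" "u < r" for u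
    using that rb by (simp add: psi_G G_F)
  interpret slow_generator_inverse F "\<lambda>u. - \<phi>' u" "psi \<phi> \<phi>'" \<kappa> r G
  proof unfold_locales
    show "- \<phi>' v \<le> - \<phi>' u" if "0 < u" "u \<le> v" "v < r" for u v
      using mono_onD[OF mono, of u v] that rb by auto
    show "0 < - \<phi>' u" if "0 < u" "u < r" for u
      using pos[of "F u"] b(2)[of u] psi_F[of u] that rb by (simp add: zero_less_mult_iff mult_less_0_iff)
    show "set_integrable lborel {u..v} (\<lambda>w. - \<phi>' w)" "F u - F v = (LBINT w:{u..v}. - \<phi>' w)"
      if "0 < u" "u \<le> v" "v < r" for u v
      using RN[of u v] that rb by (auto simp: set_integral_uminus set_integrable_def set_lebesgue_integral_def)
    show "((\<lambda>u. u * - \<phi>' u / F u) \<longlongrightarrow> 0) (at_right 0)"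
      using tendsto_minus[OF assms(7)] by (simp add: F_def)
  qed (use rb assms(8) F_top psi_F G_F in auto)
  have "((\<lambda>s. 1 / gen_inverse \<phi> (of_nat (card I) * \<phi> s) *
              \<P>(\<omega> in M. \<forall>i\<in>I. U i \<omega> \<le> s * x i))
         \<longlongrightarrow> (\<Prod>i\<in>I. x i powr (real (card I) powr (- \<kappa>)))) (at_right 0)"
    if I: "I \<noteq> {}" "I \<subseteq> {1..d}" and x: "\<And>i. i \<in> I \<Longrightarrow> x i > 0" for I x
  \<comment> \<open>Once \<open>s\<close> and all \<open>s * x i\<close> lie below
    \<open>r \<le> 1\<close>, the arguments are in the unit cube and the generator values are
    finite, so the probability and the normalising term are both values of \<open>G\<close> at real
    arguments.\<close>
  proof (rule Lim_transform_eventually[OF G_sum_scale[OF _ I(1) x]])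
    show fin: "finite I" using I(2) finite_subset by blast
    have "\<forall>\<^sub>F s in at_right 0. \<forall>i\<in>I. 0 < s * x i \<and> s * x i < r"
      using x by (intro eventually_ball_finite fin ballI) (auto intro: eventually_mono[OF eventually_scale])
    with eventually_scale[of 1, simplified]
    show "\<forall>\<^sub>F s in at_right 0. G (\<Sum>i\<in>I. F (s * x i)) / G (real (card I) * F s) =
        1 / gen_inverse \<phi> (of_nat (card I) * \<phi> s) * \<P>(\<omega> in M. \<forall>i\<in>I. U i \<omega> \<le> s * x i)"
    proof eventually_elim
      case (elim s)
      have "\<P>(\<omega> in M. \<forall>i\<in>I. U i \<omega> \<le> s * x i) = archimedean_copula d \<phi> (\<lambda>i. if i \<in> I then s * x i else 1)"
        using elim rb by (intro has_df_on_cube_margin[OF assms(5)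
              archimedean_copula_one[OF assms(3) d \<phi>1] I(2)]) fastforce
      also have "\<dots> = gen_inverse \<phi> (\<Sum>i\<in>I. \<phi> (s * x i))"
        using \<phi>1 I(2) by (rule archimedean_copula_margin)
      also have "(\<Sum>i\<in>I. \<phi> (s * x i)) = (\<Sum>i\<in>I. ennreal (F (s * x i)))"
        using elim rb by (intro sum.cong refl \<phi>_F) fastforce+
      also have "\<dots> = ennreal (\<Sum>i\<in>I. F (s * x i))"
        by (intro sum_ennreal F_nonneg)
      finally have 1: "\<P>(\<omega> in M. \<forall>i\<in>I. U i \<omega> \<le> s * x i) = G (\<Sum>i\<in>I. F (s * x i))"
        by (simp add: G_def)
      have "of_nat (card I) * \<phi> s = ennreal (real (card I) * F s)"
        using elim rb \<phi>_F[of s] by (simp add: ennreal_mult F_nonneg ennreal_of_nat_eq_real_of_nat)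
      hence 2: "gen_inverse \<phi> (of_nat (card I) * \<phi> s) = G (real (card I) * F s)"
        by (simp add: G_def)
      show ?case unfolding 1 2 by simp
    qed
  qed
  thus ?thesis using index_le_1 by blast
qed

end
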